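(* For every digraph $G$, $$\zeta(G)\le d\text{-}\mathrm{pw}(G)+1,$$ where $d\text{-}\mathrm{pw}(G)$ is the directed pathwidth of $G$.
   Context: All digraphs are finite, nonempty, simple and oriented (no loops, at most one arc between any two distinct vertices), and need not be strongly connected. A directed path-decomposition of a digraph $G$ is a sequence $W_1,W_2,\ldots,W_r$ of subsets of $V(G)$ such that: (i) $\bigcup_{i=1}^r W_i=V(G)$; (ii) if $i<j<l$ then $W_i\cap W_l\subseteq W_j$; (iii) if $(v,u)$ is an arc of $G$ (from $v$ to $u$), then either $u,v\in W_i$ for some $i$, or $v\in W_i$ and $u\in W_j$ for some $i<j$. Its width is $\max_i|W_i|-1$, and the directed pathwidth $d\text{-}\mathrm{pw}(G)$ is the minimum width over all directed path-decompositions of $G$. $d(u,v)$ is the length of a shortest directed path from $u$ to $v$, and $d(u,v)=\infty$ if there is no such path. The Localization game with $k$ cops on $G$: an invisible robber first chooses a vertex; in each round the cops choose vertices $u_1,\dots,u_k$ (any vertices, chosen afresh each round) and learn the distance vector $(d(u_1,x),\ldots,d(u_k,x))$, where $x$ is the robber's current vertex; then the robber stays at $x$ or moves along an arc $(x,y)$ to an out-neighbor $y$. The cops win if they have a strategy which, whatever the robber does, after finitely many rounds determines a unique possible vertex for the robber right after a probe (using all information received so far); otherwise the robber wins. The localization number $\zeta(G)$ is the least positive integer $k$ for which $k$ cops have a winning strategy. *)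

theory Defs
  imports "Graph_Theory.Graph_Theory" "HOL-Library.Extended_Nat"
begin

section \<open>Oriented digraphs and distance\<close>

locale oriented_digraph = digraph G for G :: "('a, 'b) pre_digraph" (structure) +
  assumes verts_nonempty: "verts G \<noteq> {}"
    and oriented: "u \<rightarrow>\<^bsub>G\<^esub> v \<Longrightarrow> \<not> v \<rightarrow>\<^bsub>G\<^esub> u"

text \<open>The infimum over the empty set is \<open>\<infinity>\<close>, so \<open>ddist G u v = \<infinity>\<close> if there is no
  directed path from \<open>u\<close> to \<open>v\<close>.\<close>

definition ddist :: "('a, 'b) pre_digraph \<Rightarrow> 'a \<Rightarrow> 'a \<Rightarrow> enat" where
  "ddist G u v = (INF p \<in> {p. pre_digraph.apath G u p v}. enat (length p))"


section \<open>Directed pathwidth\<close>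

definition directed_path_decomposition :: "('a, 'b) pre_digraph \<Rightarrow> 'a set list \<Rightarrow> bool" where
  "directed_path_decomposition G W \<longleftrightarrow>
     (\<Union>i<length W. W ! i) = verts G \<and>
     (\<forall>i j l. i < j \<and> j < l \<and> l < length W \<longrightarrow> W ! i \<inter> W ! l \<subseteq> W ! j) \<and>
     (\<forall>v u. v \<rightarrow>\<^bsub>G\<^esub> u \<longrightarrow>
        (\<exists>i<length W. v \<in> W ! i \<and> u \<in> W ! i) \<or>
        (\<exists>i j. i < j \<and> j < length W \<and> v \<in> W ! i \<and> u \<in> W ! j))"

text \<open>If \<open>G\<close> is nonempty, every decomposition has a nonempty bag, so the subtraction on
  \<^typ>\<open>nat\<close> does not truncate.\<close>

definition decomposition_width :: "'a set list \<Rightarrow> nat" where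
  "decomposition_width W = Max (card ` set W) - 1"

definition directed_pathwidth :: "('a, 'b) pre_digraph \<Rightarrow> nat" where
  "directed_pathwidth G =
     (LEAST w. \<exists>W. directed_path_decomposition G W \<and> decomposition_width W = w)"


section \<open>The Localization game\<close>

text \<open>The cops see only the distance vectors, so a strategy maps the list of distance vectors
  obtained so far (oldest first) to the next probe. Their own earlier probes are determined
  by these.\<close>

type_synonym 'a cop_strategy = "enat list list \<Rightarrow> 'a list"

definition cop_strategy :: "('a, 'b) pre_digraph \<Rightarrow> nat \<Rightarrow> 'a cop_strategy \<Rightarrow> bool" where
  "cop_strategy G k \<sigma> \<longleftrightarrow> (\<forall>h. length (\<sigma> h) = k \<and> set (\<sigma> h) \<subseteq> verts G)"

text \<open>\<open>x n\<close> is the position of the robber when the probe of round \<open>n\<close> (counted from \<open>0\<close>)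
  is made.\<close>

definition robber_walk :: "('a, 'b) pre_digraph \<Rightarrow> (nat \<Rightarrow> 'a) \<Rightarrow> bool" where
  "robber_walk G x \<longleftrightarrow> x 0 \<in> verts G \<and> (\<forall>n. x (Suc n) = x n \<or> x n \<rightarrow>\<^bsub>G\<^esub> x (Suc n))"

text \<open>The distance vectors obtained in the first \<open>n\<close> rounds.\<close>

primrec observations ::
  "('a, 'b) pre_digraph \<Rightarrow> 'a cop_strategy \<Rightarrow> (nat \<Rightarrow> 'a) \<Rightarrow> nat \<Rightarrow> enat list list" where
  "observations G \<sigma> x 0 = []"
| "observations G \<sigma> x (Suc n) =
     observations G \<sigma> x n @ [map (\<lambda>u. ddist G u (x n)) (\<sigma> (observations G \<sigma> x n))]"

text \<open>The robber is located right after the probe of round \<open>n\<close> if all robber walks consistent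
  with the observations of rounds \<open>0, \<dots>, n\<close> are at the same vertex in round \<open>n\<close>.\<close>

definition located ::
  "('a, 'b) pre_digraph \<Rightarrow> 'a cop_strategy \<Rightarrow> (nat \<Rightarrow> 'a) \<Rightarrow> nat \<Rightarrow> bool" where
  "located G \<sigma> x n \<longleftrightarrow>
     (\<forall>y. robber_walk G y \<and> observations G \<sigma> y (Suc n) = observations G \<sigma> x (Suc n)
        \<longrightarrow> y n = x n)"

definition cops_win :: "('a, 'b) pre_digraph \<Rightarrow> nat \<Rightarrow> bool" where
  "cops_win G k \<longleftrightarrow>
     (\<exists>\<sigma>. cop_strategy G k \<sigma> \<and> (\<forall>x. robber_walk G x \<longrightarrow> (\<exists>n. located G \<sigma> x n)))"

definition localization_number :: "('a, 'b) pre_digraph \<Rightarrow> nat" where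
  "localization_number G = (LEAST k. 0 < k \<and> cops_win G k)"


section \<open>The minima are attained\<close>

lemma (in wf_digraph) ddist_eq_0_iff:
  assumes "u \<in> verts G"
  shows "ddist G u v = 0 \<longleftrightarrow> u = v"
proof
  assume "ddist G u v = 0"
  then have "ddist G u v < enat 1" by (simp add: zero_enat_def)
  then obtain p where "apath u p v" "enat (length p) < enat 1"
    unfolding ddist_def INF_less_iff by auto
  then show "u = v" by (auto simp: apath_def awalk_def)
next
  assume "u = v"
  with assms have "apath u [] v" by (simp add: apath_def awalk_Nil_iff)
  then have "ddist G u v \<le> enat (length ([] :: 'b list))"
    unfolding ddist_def by (intro INF_lower) simp
  then show "ddist G u v = 0" by (simp add: enat_0)
qed

lemma (in wf_digraph) directed_pathwidth_attained:
  "\<exists>W. directed_path_decomposition G W \<and> decomposition_width W = directed_pathwidth G"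
proof -
  have "directed_path_decomposition G [verts G]"
    by (auto simp: directed_path_decomposition_def arcs_ends_conv)
  then have "\<exists>w W. directed_path_decomposition G W \<and> decomposition_width W = w" by blast
  then show ?thesis unfolding directed_pathwidth_def by (rule LeastI_ex)
qed

lemma (in oriented_digraph) localization_number_attained:
  "0 < localization_number G \<and> cops_win G (localization_number G)"
proof -
  obtain vs where vs: "set vs = verts G" "distinct vs"
    using finite_distinct_list[OF finite_verts] by blast
  have "located G (\<lambda>_. vs) x 0" if "robber_walk G x" for x
    unfolding located_def
  proof (intro allI impI, elim conjE)
    fix y
    assume y: "robber_walk G y"
      and eq: "observations G (\<lambda>_. vs) y (Suc 0) = observations G (\<lambda>_. vs) x (Suc 0)"
    from y have "y 0 \<in> verts G" by (simp add: robber_walk_def)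
    moreover from eq have "\<forall>u\<in>set vs. ddist G u (y 0) = ddist G u (x 0)" by simp
    ultimately have "ddist G (y 0) (x 0) = ddist G (y 0) (y 0)" using vs by simp
    with \<open>y 0 \<in> verts G\<close> show "y 0 = x 0" by (metis ddist_eq_0_iff)
  qed
  then have "cops_win G (length vs)"
    unfolding cops_win_def cop_strategy_def using vs by (intro exI[of _ "\<lambda>_. vs"]) auto
  moreover have "0 < length vs" using vs verts_nonempty by auto
  ultimately have "\<exists>k. 0 < k \<and> cops_win G k" by blast
  then show ?thesis unfolding localization_number_def by (rule LeastI_ex)
qed

end

theory Submission
  imports Defs
begin

text \<open>
  The cops sweep a path-decomposition of minimum width from left to right, probing in round \<open>i\<close>
  the whole \<open>i\<close>-th bag. A probed vertex has distance \<open>0\<close> to itself and to nothing else, so the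
  robber is located as soon as a probe hits the robber's vertex (\<open>located_if_probed\<close>).

  A robber who escapes every probe is pushed to the right (\<open>swept_bag_evaded\<close>). Every vertex
  occupies an interval of bags, and an arc \<open>(v, u)\<close> always leads from some bag of \<open>v\<close> to the
  same or a later bag of \<open>u\<close>. If all bags of \<open>v\<close> lie to the right of the cops, then so does
  some bag of \<open>u\<close>; if the next bag does not contain \<open>u\<close>, then the interval of \<open>u\<close> lies
  entirely to the right of it. So an arc can lead back to a vertex that has already swept bags,
  but such a vertex also lies in the bag that is probed next. After the last bag no vertex is
  left.

  A bag has at most one vertex more than the width, which gives the number of cops.
\<close>

context wf_digraph
begin

lemma located_if_probed:
  assumes "x n \<in> verts G" and probed: "x n \<in> set (\<sigma> (observations G \<sigma> x n))"
  shows "located G \<sigma> x n"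
  unfolding located_def
proof (intro allI impI, elim conjE)
  fix y
  assume "observations G \<sigma> y (Suc n) = observations G \<sigma> x (Suc n)"
  with probed have "ddist G (x n) (y n) = ddist G (x n) (x n)"
    by auto
  with \<open>x n \<in> verts G\<close> show "y n = x n" by (metis ddist_eq_0_iff)
qed

lemma robber_walk_in_verts:
  assumes "robber_walk G x"
  shows "x n \<in> verts G"
proof (induction n)
  case 0
  from assms show ?case by (simp add: robber_walk_def)
next
  case (Suc n)
  from assms have "x (Suc n) = x n \<or> x n \<rightarrow>\<^bsub>G\<^esub> x (Suc n)" by (simp add: robber_walk_def)
  with Suc show ?case using adj_in_verts(2) by metis
qed

text \<open>The invariant of the sweep: the bags that have been probed stay free of the robber.\<close>

lemma swept_bag_evaded:
  assumes W: "directed_path_decomposition G W" and x: "robber_walk G x"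
    and evade: "\<And>m. m \<le> n \<Longrightarrow> x m \<notin> W ! m"
    and "n < length W" "m \<le> n"
  shows "x n \<notin> W ! m"
  using evade \<open>n < length W\<close> \<open>m \<le> n\<close>
proof (induction n arbitrary: m)
  case 0
  then show ?case by simp
next
  case (Suc n)
  have swept: "x n \<notin> W ! m" if "m \<le> n" for m
    using Suc.IH[OF _ _ that] Suc.prems(1,2) by simp
  \<comment> \<open>Staying put counts as an arc here: both ends share a bag, as the bags cover the graph.\<close>
  have "\<exists>i j. i \<le> j \<and> j < length W \<and> x n \<in> W ! i \<and> x (Suc n) \<in> W ! j"
  proof (cases "x (Suc n) = x n")
    case True
    have "x n \<in> (\<Union>i<length W. W ! i)"
      using robber_walk_in_verts[OF x] W by (simp add: directed_path_decomposition_def)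
    with True show ?thesis by auto
  next
    case False
    with x have "x n \<rightarrow>\<^bsub>G\<^esub> x (Suc n)" by (auto simp: robber_walk_def)
    with W show ?thesis
      unfolding directed_path_decomposition_def by (meson order_refl less_imp_le)
  qed
  then obtain i j where ij: "i \<le> j" "j < length W" "x n \<in> W ! i" "x (Suc n) \<in> W ! j" by blast
  then have "n < i" using swept by (meson not_le)
  with ij Suc.prems(1)[of "Suc n"] have j: "Suc n < j" by (cases "j = Suc n") auto
  show ?case
  proof
    assume m: "x (Suc n) \<in> W ! m"
    with Suc.prems(1,3) have "m < Suc n" by (metis le_neq_implies_less order_refl)
    \<comment> \<open>A bag of the new vertex before the probed one and one after it enclose the probe.\<close>
    with j ij(2) W have "W ! m \<inter> W ! j \<subseteq> W ! Suc n"
      unfolding directed_path_decomposition_def by blast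
    with m ij(4) Suc.prems(1)[of "Suc n"] show False by blast
  qed
qed

lemma sweep_hits_robber:
  assumes W: "directed_path_decomposition G W" and x: "robber_walk G x"
  shows "\<exists>n<length W. x n \<in> W ! n"
proof (rule ccontr)
  assume contr: "\<not> ?thesis"
  let ?last = "length W - 1"
  have "x ?last \<in> (\<Union>i<length W. W ! i)"
    using robber_walk_in_verts[OF x] W by (simp add: directed_path_decomposition_def)
  then obtain m where m: "m < length W" "x ?last \<in> W ! m" by blast
  have "x ?last \<notin> W ! m"
    by (rule swept_bag_evaded[OF W x]) (use contr m(1) in auto)
  with m(2) show False by blast
qed

text \<open>The cops need exactly \<open>k\<close> probes in every round, so smaller bags, and the rounds after the
  sweep, are padded with an arbitrary vertex.\<close>

lemma cops_win_if_small_bags: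
  assumes W: "directed_path_decomposition G W" and "verts G \<noteq> {}"
    and small: "\<And>B. B \<in> set W \<Longrightarrow> finite B \<and> card B \<le> k"
  shows "cops_win G k"
proof -
  obtain v where v: "v \<in> verts G" using \<open>verts G \<noteq> {}\<close> by blast
  have "\<exists>us. length us = k \<and> set us \<subseteq> verts G \<and> (i < length W \<longrightarrow> W ! i \<subseteq> set us)" for i
  proof (cases "i < length W")
    case True
    have "W ! i \<subseteq> verts G" using W True by (auto simp: directed_path_decomposition_def)
    moreover obtain us where "set us = W ! i" "length us = card (W ! i)"
      using small True by (metis nth_mem finite_distinct_list distinct_card)
    moreover have "card (W ! i) \<le> k" using small True by simp
    ultimately show ?thesis
      using v by (intro exI[of _ "us @ replicate (k - length us) v"]) auto
  next
    case False
    then show ?thesis using v by (intro exI[of _ "replicate k v"]) auto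
  qed
  then obtain probe where probe: "\<And>i. length (probe i) = k" "\<And>i. set (probe i) \<subseteq> verts G"
    "\<And>i. i < length W \<Longrightarrow> W ! i \<subseteq> set (probe i)"
    by metis
  \<comment> \<open>The sweep ignores the answers: only their number, which is the round, matters.\<close>
  define \<sigma> :: "enat list list \<Rightarrow> 'a list" where "\<sigma> h = probe (length h)" for h
  have round: "length (observations G \<sigma> x n) = n" for x n
    by (induction n) simp_all
  have "\<exists>n. located G \<sigma> x n" if x: "robber_walk G x" for x
  proof -
    obtain n where "n < length W" "x n \<in> W ! n" using sweep_hits_robber[OF W x] by blast
    then have "x n \<in> set (\<sigma> (observations G \<sigma> x n))"
      using probe(3) by (auto simp: \<sigma>_def round)
    then show ?thesis using located_if_probed robber_walk_in_verts[OF x] by blast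
  qed
  moreover have "cop_strategy G k \<sigma>" using probe by (simp add: cop_strategy_def \<sigma>_def)
  ultimately show ?thesis by (auto simp: cops_win_def)
qed

end

theorem theorem12:
  fixes G :: "('a, 'b) pre_digraph"
  assumes "oriented_digraph G"
  shows "localization_number G \<le> directed_pathwidth G + 1"
proof -
  interpret oriented_digraph G by (rule assms)
  obtain W where W: "directed_path_decomposition G W"
    and width: "decomposition_width W = directed_pathwidth G"
    using directed_pathwidth_attained by blast
  have "finite B \<and> card B \<le> directed_pathwidth G + 1" if "B \<in> set W" for B
  proof
    have "(\<Union>i<length W. W ! i) = verts G"
      using W by (simp add: directed_path_decomposition_def)
    with that have "B \<subseteq> verts G" by (auto simp: in_set_conv_nth)
    then show "finite B" using finite_verts finite_subset by blast
    have "card B \<le> Max (card ` set W)" using that by simp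
    then show "card B \<le> directed_pathwidth G + 1"
      using width by (simp add: decomposition_width_def)
  qed
  then have "cops_win G (directed_pathwidth G + 1)"
    by (rule cops_win_if_small_bags[OF W verts_nonempty])
  then show ?thesis unfolding localization_number_def by (intro Least_le) simp
qed

end
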